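(* Let $n \ge 1$ be an integer and let $M = (S, \mathcal{I})$ be the binary matroid whose ground set $S$ is the set of all $2^n - 1$ nonzero vectors in $\mathbb{F}_2^n$, where a subset of $S$ is independent if and only if it is linearly independent over $\mathbb{F}_2$; let $k$ denote the coloring number of $M$. Let $b$ be a positive integer and $c > 0$. If $M$ admits a $(b,c)$-decomposition, then $4c^2\, 2^{d^2+d} \ge n$, where $d$ is the minimum positive integer such that $(2^d - 1)/d > b$. In particular, for any fixed constants $b$ and $c$, for all sufficiently large $n$ the matroid $M$ admits no $(b,c)$-decomposition.
   Context: A subset $R$ of the ground set of a matroid is $k$-colorable if it can be partitioned into $k$ independent sets; the coloring number of a matroid is the smallest $k$ such that its whole ground set is $k$-colorable. For a $k$-colorable matroid $M=(S,\mathcal{I})$ with coloring number $k$, a $(b,c)$-decomposition is a partition $\{X_1, \dots, X_\ell\}$ of $S$ such that (i) $|X_i| \le c \cdot k$ for all $i \in [\ell]$, and (ii) every set $Y = \{v_1, \dots, v_\ell\}$ with $v_i \in X_i$ for each $i$ is $b$-colorable. $M$ is $(b,c)$-decomposable if it admits such a partition. *)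

theory Defs
  imports
    Complex_Main
    "HOL-Library.Z2"
    "HOL-Library.Function_Algebras"
    "HOL-Library.FuncSet"
    "HOL-Library.Disjoint_Sets"
begin

locale matroid =
  fixes S :: "'a set" and Is :: "'a set set"
  assumes finite_ground: "finite S"
    and indep_subset_ground: "A \<in> Is \<Longrightarrow> A \<subseteq> S"
    and empty_indep: "{} \<in> Is"
    and indep_hereditary: "A \<in> Is \<Longrightarrow> B \<subseteq> A \<Longrightarrow> B \<in> Is"
    and augmentation: "A \<in> Is \<Longrightarrow> B \<in> Is \<Longrightarrow> card A < card B \<Longrightarrow> \<exists>x\<in>B - A. insert x A \<in> Is"
begin

text \<open>The \<open>k\<close> colour classes may be empty, so that a \<open>k\<close>-colorable set is also \<open>k + 1\<close>-colorable.\<close>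

definition colorable :: "nat \<Rightarrow> 'a set \<Rightarrow> bool" where
  "colorable k R \<longleftrightarrow>
     (\<exists>C :: nat \<Rightarrow> 'a set. (\<Union>i<k. C i) = R \<and> disjoint_family_on C {..<k} \<and> (\<forall>i<k. C i \<in> Is))"

text \<open>This is meaningful only for a loopless matroid; a matroid with a loop is not \<open>k\<close>-colorable
  for any \<open>k\<close>.\<close>

definition coloring_number :: nat where
  "coloring_number = (LEAST k. colorable k S)"

text \<open>The blocks of a \<open>partition_on\<close> are nonempty, hence condition (ii), which ranges over all
  transversals of the partition, is never vacuous.\<close>

definition is_decomposition :: "nat \<Rightarrow> real \<Rightarrow> 'a set set \<Rightarrow> bool" where
  "is_decomposition b c P \<longleftrightarrow>
     partition_on S P \<and>
     (\<forall>X\<in>P. real (card X) \<le> c * real coloring_number) \<and>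
     (\<forall>v. (\<forall>X\<in>P. v X \<in> X) \<longrightarrow> colorable b (v ` P))"

definition decomposable :: "nat \<Rightarrow> real \<Rightarrow> bool" where
  "decomposable b c \<longleftrightarrow> (\<exists>P. is_decomposition b c P)"

end

text \<open>The space \<open>F\<^sub>2\<^sup>n\<close> is represented by the functions \<open>nat \<Rightarrow> bit\<close> that vanish outside
  \<open>{..<n}\<close>, with pointwise operations; \<open>bit\<close> is the field with two elements.\<close>

definition scale_F2 :: "bit \<Rightarrow> (nat \<Rightarrow> bit) \<Rightarrow> (nat \<Rightarrow> bit)" where
  "scale_F2 a v = (\<lambda>i. a * v i)"

interpretation F2: vector_space scale_F2
  by unfold_locales
    (simp_all only: scale_F2_def plus_fun_def distrib_left distrib_right mult.assoc mult_1_left)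

definition F2_space :: "nat \<Rightarrow> (nat \<Rightarrow> bit) set" where
  "F2_space n = {v. \<forall>i\<ge>n. v i = 0}"

definition F2_ground :: "nat \<Rightarrow> (nat \<Rightarrow> bit) set" where
  "F2_ground n = F2_space n - {0}"

definition F2_indep :: "nat \<Rightarrow> (nat \<Rightarrow> bit) set set" where
  "F2_indep n = {A. A \<subseteq> F2_ground n \<and> F2.independent A}"

lemma UNIV_bit_eq: "(UNIV :: bit set) = {0, 1}"
proof
  show "UNIV \<subseteq> {0, 1 :: bit}"
  proof
    fix a :: bit
    show "a \<in> {0, 1}" by (cases a) simp_all
  qed
qed simp

lemma bij_betw_F2_space: "bij_betw (\<lambda>v. restrict v {..<n}) (F2_space n) ({..<n} \<rightarrow>\<^sub>E UNIV)"
  unfolding bij_betw_def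
proof
  show "inj_on (\<lambda>v. restrict v {..<n}) (F2_space n)"
  proof (rule inj_onI, rule ext)
    fix v w :: "nat \<Rightarrow> bit" and i
    assume "v \<in> F2_space n" "w \<in> F2_space n" and eq: "restrict v {..<n} = restrict w {..<n}"
    then have out: "i \<ge> n \<Longrightarrow> v i = w i" unfolding F2_space_def by simp
    have "i < n \<Longrightarrow> v i = w i" using fun_cong[OF eq, of i] by simp
    with out show "v i = w i" using le_less_linear by blast
  qed
  show "(\<lambda>v. restrict v {..<n}) ` F2_space n = {..<n} \<rightarrow>\<^sub>E UNIV"
  proof (intro equalityI subsetI)
    fix f :: "nat \<Rightarrow> bit" assume f: "f \<in> {..<n} \<rightarrow>\<^sub>E UNIV"
    show "f \<in> (\<lambda>v. restrict v {..<n}) ` F2_space n"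
    proof (rule image_eqI)
      show "(\<lambda>i. if i < n then f i else 0) \<in> F2_space n" unfolding F2_space_def by simp
      show "f = restrict (\<lambda>i. if i < n then f i else 0) {..<n}"
      proof
        fix i show "f i = restrict (\<lambda>i. if i < n then f i else 0) {..<n} i"
          by (cases "i < n") (simp_all add: PiE_arb[OF f])
      qed
    qed
  qed (erule imageE, simp)
qed

lemma finite_F2_space: "finite (F2_space n)"
proof -
  have "finite ({..<n} \<rightarrow>\<^sub>E (UNIV :: bit set))"
    by (intro finite_PiE) (auto simp: UNIV_bit_eq)
  then show ?thesis
    using bij_betw_finite[OF bij_betw_F2_space[of n]] by simp
qed

lemma card_F2_space: "card (F2_space n) = 2 ^ n"
  using bij_betw_same_card[OF bij_betw_F2_space[of n]] by (simp add: card_PiE UNIV_bit_eq numeral_2_eq_2)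

lemma finite_F2_ground: "finite (F2_ground n)"
  by (simp add: F2_ground_def finite_F2_space)

lemma card_F2_ground: "card (F2_ground n) = 2 ^ n - 1"
proof -
  have "0 \<in> F2_space n" by (simp add: F2_space_def zero_fun_def)
  then show ?thesis by (simp add: F2_ground_def card_F2_space finite_F2_space)
qed

lemma matroid_F2: "matroid (F2_ground n) (F2_indep n)"
proof
  show "finite (F2_ground n)" by (rule finite_F2_ground)
  show "A \<subseteq> F2_ground n" if "A \<in> F2_indep n" for A
    using that by (simp add: F2_indep_def)
  show "{} \<in> F2_indep n"
    by (simp add: F2_indep_def F2.independent_empty)
  show "B \<in> F2_indep n" if "A \<in> F2_indep n" "B \<subseteq> A" for A B
    using that F2.independent_mono by (auto simp: F2_indep_def)
  show "\<exists>x\<in>B - A. insert x A \<in> F2_indep n"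
    if A: "A \<in> F2_indep n" and B: "B \<in> F2_indep n" and less: "card A < card B" for A B
  proof -
    have "finite A"
      using A finite_F2_ground finite_subset by (auto simp: F2_indep_def)
    have "\<not> B \<subseteq> F2.span A"
    proof
      assume "B \<subseteq> F2.span A"
      then have "card B \<le> card A"
        using F2.independent_span_bound[OF \<open>finite A\<close>] B by (auto simp: F2_indep_def)
      with less show False by simp
    qed
    then obtain x where x: "x \<in> B" "x \<notin> F2.span A" by blast
    then have "x \<notin> A" using F2.span_base by blast
    moreover have "F2.independent (insert x A)"
      using x A F2.independent_insertI by (auto simp: F2_indep_def)
    ultimately show ?thesis
      using x A B by (auto simp: F2_indep_def)
  qed
qed

lemma colorable_coloring_number_F2:
  "matroid.colorable (F2_indep n) (matroid.coloring_number (F2_ground n) (F2_indep n)) (F2_ground n)"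
proof -
  interpret matroid "F2_ground n" "F2_indep n" by (rule matroid_F2)
  obtain h where h: "bij_betw h {..<card (F2_ground n)} (F2_ground n)"
    using ex_bij_betw_nat_finite[OF finite_F2_ground] by (auto simp: atLeast0LessThan)
  have "colorable (card (F2_ground n)) (F2_ground n)"
    unfolding colorable_def
  proof (intro exI conjI allI impI)
    show "(\<Union>i<card (F2_ground n). {h i}) = F2_ground n"
      using h by (auto simp: bij_betw_def)
    show "disjoint_family_on (\<lambda>i. {h i}) {..<card (F2_ground n)}"
      using h by (auto simp: disjoint_family_on_def bij_betw_def inj_on_def)
    show "{h i} \<in> F2_indep n" if "i < card (F2_ground n)" for i
    proof -
      have "h i \<in> F2_ground n" using h that by (auto simp: bij_betw_def)
      then show ?thesis by (simp add: F2_indep_def F2_ground_def)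
    qed
  qed
  then show ?thesis
    unfolding coloring_number_def by (rule LeastI)
qed

end

theory Submission
  imports Defs
begin

text \<open>
  Greedy coloring gives \<open>n * k \<le> 2 * 2\<^sup>n\<close>. Choose \<open>d\<close> vectors of \<open>F\<^sub>2\<^sup>n\<close> at random. The sums over
  two distinct nonempty subsets of the \<open>d\<close> vectors are independent and uniform, so they lie in a common
  block (or are both zero) with probability at most \<open>c * k / 2\<^sup>n\<close>. If
  \<open>4\<^sup>d * c * k < 2\<^sup>n\<close>, some choice therefore puts all \<open>2\<^sup>d - 1\<close> subset sums into different
  blocks; they are the nonzero vectors of a \<open>d\<close>-dimensional subspace and extend to a transversal,
  whose \<open>b\<close> colour classes each contain at most \<open>d\<close> of them, contradicting \<open>(2\<^sup>d - 1) / d > b\<close>.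
  Hence \<open>n \<le> 2 * c * 4\<^sup>d\<close>. For small \<open>c\<close> this is combined with \<open>1 \<le> 4 * b * c\<close>, which
  holds because a transversal has at most \<open>b * n\<close> elements.
\<close>

section \<open>Colorability in an arbitrary matroid\<close>

lemma (in matroid) colorable_subset:
  assumes "colorable k R" "Q \<subseteq> R"
  shows "colorable k Q"
proof -
  obtain C :: "nat \<Rightarrow> 'a set" where C: "(\<Union>i<k. C i) = R" "disjoint_family_on C {..<k}" "\<forall>i<k. C i \<in> Is"
    using assms(1) unfolding colorable_def by blast
  have "(\<Union>i<k. C i \<inter> Q) = Q" using C(1) assms(2) by blast
  moreover have "disjoint_family_on (\<lambda>i. C i \<inter> Q) {..<k}"
    using C(2) unfolding disjoint_family_on_def by blast
  moreover have "\<forall>i<k. C i \<inter> Q \<in> Is" using C(3) indep_hereditary by blast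
  ultimately show ?thesis unfolding colorable_def by (intro exI[of _ "\<lambda>i. C i \<inter> Q"]) simp
qed

text \<open>Only independent sets inside \<open>R\<close> are bounded, so this serves both a whole
  transversal with \<open>r = n\<close> and a set of vectors spanned by \<open>d\<close> vectors
  with \<open>r = d\<close>.\<close>

lemma (in matroid) card_colorable_le:
  assumes "colorable k R" and rank: "\<And>A. A \<in> Is \<Longrightarrow> A \<subseteq> R \<Longrightarrow> card A \<le> r"
  shows "card R \<le> k * r"
proof -
  obtain C :: "nat \<Rightarrow> 'a set" where C: "(\<Union>i<k. C i) = R" "\<forall>i<k. C i \<in> Is"
    using assms(1) unfolding colorable_def by blast
  have "card R \<le> (\<Sum>i<k. card (C i))"
    unfolding C(1)[symmetric] by (rule card_UN_le) simp
  also have "\<dots> \<le> (\<Sum>i<k. r)"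
    by (intro sum_mono rank) (use C in auto)
  finally show ?thesis by simp
qed

lemma (in matroid) colorable_Suc_class:
  assumes "colorable k (R - B)" "B \<in> Is" "B \<subseteq> R"
  shows "colorable (Suc k) R"
proof -
  obtain C :: "nat \<Rightarrow> 'a set" where C: "(\<Union>i<k. C i) = R - B" "disjoint_family_on C {..<k}" "\<forall>i<k. C i \<in> Is"
    using assms(1) unfolding colorable_def by blast
  have Ck: "\<And>i. i < k \<Longrightarrow> C i \<inter> B = {}" using C(1) by blast
  define D where "D = C(k := B)"
  have "(\<Union>i<Suc k. D i) = B \<union> (\<Union>i<k. C i)"
    unfolding D_def lessThan_Suc by auto
  also have "\<dots> = R" unfolding C(1) using assms(3) by blast
  finally have "(\<Union>i<Suc k. D i) = R" .
  moreover have "disjoint_family_on D {..<Suc k}"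
    unfolding disjoint_family_on_def
  proof (intro ballI impI)
    fix i j assume "i \<in> {..<Suc k}" "j \<in> {..<Suc k}" "i \<noteq> j"
    then show "D i \<inter> D j = {}"
      using C(2) Ck[of i] Ck[of j] unfolding D_def disjoint_family_on_def
      by (cases "i = k"; cases "j = k") auto
  qed
  moreover have "\<forall>i<Suc k. D i \<in> Is"
    using C(3) assms(2) by (simp add: D_def less_Suc_eq)
  ultimately show ?thesis unfolding colorable_def by (intro exI[of _ D]) simp
qed

lemma (in matroid) colorable_mono:
  assumes "colorable k R" "k \<le> l"
  shows "colorable l R"
  using assms(2)
proof (induction l rule: dec_induct)
  case base show ?case by (rule assms(1))
next
  case (step m)
  show ?case by (rule colorable_Suc_class[where B = "{}"]) (simp_all add: step.IH empty_indep)
qed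

section \<open>Greedy coloring and the number of its classes\<close>

text \<open>Greedily remove independent sets: while at least \<open>2\<^sup>i\<close> elements are left, each colour class
  takes away \<open>i + 1\<close> of them.\<close>

lemma (in matroid) greedy_coloring:
  assumes large: "\<And>R i. R \<subseteq> S \<Longrightarrow> 2 ^ i \<le> card R \<Longrightarrow> \<exists>B\<in>Is. B \<subseteq> R \<and> card B = Suc i"
    and "R \<subseteq> S" "card R < 2 ^ m"
  shows "colorable (\<Sum>i<m. (2 ^ i - 1) div Suc i + 1) R"
  using assms(2,3)
proof (induction m arbitrary: R)
  case 0
  then have "R = {}" using finite_ground finite_subset by fastforce
  then show ?case by (simp add: colorable_def disjoint_family_on_def)
next
  case (Suc m)
  let ?g = "\<Sum>i<m. (2 ^ i - 1) div Suc i + 1"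
  \<comment> \<open>Up to \<open>t\<close> classes of size \<open>m + 1\<close> are removed until
    fewer than \<open>2 ^ m\<close> elements are left, which the outer induction hypothesis colors
    with \<open>?g\<close> classes. If this happens early, empty classes fill up the number.\<close>
  have step: "colorable (?g + t) R" if "R \<subseteq> S" "card R < 2 ^ m + Suc m * t" for t R
    using that
  proof (induction t arbitrary: R)
    case 0
    then show ?case using Suc.IH by simp
  next
    case (Suc t)
    show ?case
    proof (cases "card R < 2 ^ m + Suc m * t")
      case True
      then show ?thesis using Suc.IH[OF Suc.prems(1)] colorable_mono by simp
    next
      case False
      then have "2 ^ m \<le> card R" by simp
      then obtain B where B: "B \<in> Is" "B \<subseteq> R" "card B = Suc m"
        using large Suc.prems(1) by blast
      then have "card (R - B) = card R - Suc m"
        using card_Diff_subset finite_subset indep_subset_ground finite_ground by metis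
      then have "card (R - B) < 2 ^ m + Suc m * t"
        using Suc.prems(2) \<open>2 ^ m \<le> card R\<close> zero_less_power[of "2 :: nat" m]
        unfolding mult_Suc_right by linarith
      then have "colorable (?g + t) (R - B)" using Suc.IH Suc.prems(1) by blast
      then show ?thesis using colorable_Suc_class[OF _ B(1,2)] by simp
    qed
  qed
  \<comment> \<open>The excess of \<open>card R\<close> over \<open>2 ^ m\<close> is at most
    \<open>2 ^ m - 1\<close>, so the rounded-down quotient plus one is enough classes to get below
    \<open>2 ^ m\<close>.\<close>
  have "2 ^ m - 1 < Suc m * ((2 ^ m - 1) div Suc m + 1)"
    using dividend_less_times_div[of "Suc m" "2 ^ m - 1"] by (simp add: algebra_simps)
  then have "card R < 2 ^ m + Suc m * ((2 ^ m - 1) div Suc m + 1)"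
    using Suc.prems(2) by simp
  from step[OF Suc.prems(1) this] show ?case by simp
qed

text \<open>Passing from \<open>n\<close> to \<open>n + 1\<close> raises the left side by at most
  \<open>2 * 2 ^ n\<close>: for \<open>n \<ge> 4\<close> the earlier sum and \<open>n + 1\<close>
  each take at most half of \<open>2 ^ n\<close>, and the new quotient times \<open>n + 1\<close> at
  most \<open>2 ^ n\<close>. The cases below \<open>4\<close> are computed.\<close>

lemma greedy_number_le:
  assumes "n \<ge> 1"
  shows "n * (\<Sum>i<n. (2 ^ i - 1) div Suc i + 1 :: nat) \<le> 2 * 2 ^ n"
proof (cases "n \<ge> 4")
  case False
  then have "n = 1 \<or> n = 2 \<or> n = 3" using assms by auto
  then show ?thesis by (auto simp: lessThan_nat_numeral simp flip: numeral_2_eq_2)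
next
  case True
  then show ?thesis
  proof (induction n rule: dec_induct)
    case base
    show ?case by (simp add: lessThan_nat_numeral flip: numeral_2_eq_2)
  next
    case (step n)
    define g where "g = (\<Sum>i<n. (2 ^ i - 1) div Suc i + 1 :: nat)"
    have ng: "n * g \<le> 2 * 2 ^ n" using step.IH by (simp add: g_def)
    define q where "q = Suc n * ((2 ^ n - 1) div Suc n)"
    have q: "q \<le> 2 ^ n"
      unfolding q_def by (rule order.trans[OF times_div_less_eq_dividend]) simp
    have exp: "2 * (n + 1) \<le> 2 ^ n"
      using step.hyps by (induction n rule: dec_induct) auto
    have "4 * g \<le> n * g" using step.hyps by simp
    then have g: "4 * g \<le> 2 * 2 ^ n" using ng by (rule order.trans)
    have "Suc n * (\<Sum>i<Suc n. (2 ^ i - 1) div Suc i + 1 :: nat) = n * g + (g + q + Suc n)"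
      by (simp add: g_def q_def algebra_simps)
    also have "\<dots> \<le> 2 * 2 ^ n + 2 * 2 ^ n"
    proof (rule add_mono[OF ng])
      show "g + q + Suc n \<le> 2 * 2 ^ n"
        using g q exp by (simp add: algebra_simps)
    qed
    finally show ?case by simp
  qed
qed

section \<open>Linear algebra over \<open>bit\<close> and the coloring number\<close>

lemma F2_add_self [simp]: "(v :: nat \<Rightarrow> bit) + v = 0"
  by (rule ext) simp

lemma F2_eq_if_add_eq_0:
  assumes "(v :: nat \<Rightarrow> bit) + w = 0"
  shows "v = w"
proof -
  have "v + w + w = w" using assms by simp
  then show ?thesis by (simp add: add.assoc)
qed

text \<open>The coefficient of \<open>x\<close> can only be \<open>0\<close> or \<open>1\<close>,
  which leaves two cosets of the old span.\<close>

lemma F2_span_insert: "F2.span (insert x A) = F2.span A \<union> (+) x ` F2.span A"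
proof -
  have "F2.span (insert x A) = {y. \<exists>a. y - scale_F2 a x \<in> F2.span A}"
    by (rule F2.span_insert)
  also have "\<dots> = {y. y \<in> F2.span A \<or> y - x \<in> F2.span A}"
  proof -
    have "(\<exists>a. P a) \<longleftrightarrow> P 0 \<or> P 1" for P :: "bit \<Rightarrow> bool"
      by (metis bit_not_one_iff)
    then show ?thesis by simp
  qed
  also have "\<dots> = F2.span A \<union> (+) x ` F2.span A"
  proof -
    have "y \<in> (+) x ` F2.span A \<longleftrightarrow> y - x \<in> F2.span A" for y
    proof
      assume "y - x \<in> F2.span A"
      then have "x + (y - x) \<in> (+) x ` F2.span A" by (rule imageI)
      then show "y \<in> (+) x ` F2.span A" by simp
    qed auto
    then show ?thesis by blast
  qed
  finally show ?thesis .
qed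

lemma card_F2_span:
  assumes "finite A" "F2.independent A"
  shows "finite (F2.span A) \<and> card (F2.span A) = 2 ^ card A"
  using assms
proof (induction A rule: finite_induct)
  case empty
  then show ?case by simp
next
  case (insert x A)
  have indep: "F2.independent A"
    using insert.prems F2.independent_mono by blast
  have x: "x \<notin> F2.span A"
    using insert.prems insert.hyps F2.independent_insert by metis
  have "F2.span A \<inter> (+) x ` F2.span A = {}"
  proof (rule ccontr)
    assume "\<not> ?thesis"
    then obtain y where "y \<in> F2.span A" "x + y \<in> F2.span A" by blast
    then have "x + y - y \<in> F2.span A" using F2.span_diff by blast
    with x show False by simp
  qed
  moreover have "card ((+) x ` F2.span A) = card (F2.span A)"
    by (rule card_image) (simp add: inj_on_def)
  ultimately show ?case
    using insert.IH[OF indep] insert.hyps by (simp add: F2_span_insert card_Un_disjoint)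
qed

lemma F2_space_subspace: "F2.subspace (F2_space n)"
  by (auto simp: F2.subspace_def F2_space_def scale_F2_def)

lemma card_F2_indep_le:
  assumes "A \<in> F2_indep n"
  shows "card A \<le> n"
proof -
  have A: "A \<subseteq> F2_space n" "F2.independent A"
    using assms by (auto simp: F2_indep_def F2_ground_def)
  then have "finite A" using finite_F2_space finite_subset by blast
  have "card (F2.span A) \<le> card (F2_space n)"
    using A F2_space_subspace F2.span_minimal by (intro card_mono finite_F2_space) blast
  then show ?thesis using card_F2_span[OF \<open>finite A\<close> A(2)] by (simp add: card_F2_space)
qed

text \<open>A maximal independent \<open>B \<subseteq> R\<close> spans \<open>R\<close>, and its
  span has \<open>2 ^ card B\<close> elements. One of these is \<open>0\<close>, which is not in
  \<open>R\<close>, so \<open>2 ^ i < 2 ^ card B\<close>; the strictness yields \<open>i + 1\<close>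
  elements rather than \<open>i\<close>.\<close>

lemma F2_large_indep_subset:
  assumes "R \<subseteq> F2_ground n" "2 ^ i \<le> card R"
  shows "\<exists>B\<in>F2_indep n. B \<subseteq> R \<and> card B = Suc i"
proof -
  obtain B where B: "B \<subseteq> R" "F2.independent B" "R \<subseteq> F2.span B"
    using F2.maximal_independent_subset by blast
  have finR: "finite R" using assms(1) finite_F2_ground finite_subset by blast
  then have finB: "finite B" using B(1) finite_subset by blast
  have "0 \<in> F2.span B - R"
    using assms(1) F2.span_zero by (auto simp: F2_ground_def)
  then have "card R < card (F2.span B)"
    using B(3) card_F2_span[OF finB B(2)] by (intro psubset_card_mono) auto
  then have "(2 :: nat) ^ i < 2 ^ card B"
    using assms(2) card_F2_span[OF finB B(2)] by linarith
  then have "Suc i \<le> card B" by simp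
  then obtain B' where B': "B' \<subseteq> B" "card B' = Suc i"
    using obtain_subset_with_card_n by blast
  then have "B' \<in> F2_indep n"
    using B assms(1) F2.independent_mono by (auto simp: F2_indep_def)
  then show ?thesis using B' B(1) by blast
qed

lemma F2_coloring_number_le:
  assumes "n \<ge> 1"
  shows "n * matroid.coloring_number (F2_ground n) (F2_indep n) \<le> 2 * 2 ^ n"
proof -
  interpret matroid "F2_ground n" "F2_indep n" by (rule matroid_F2)
  have "colorable (\<Sum>i<n. (2 ^ i - 1) div Suc i + 1) (F2_ground n)"
    by (intro greedy_coloring F2_large_indep_subset) (simp_all add: card_F2_ground)
  then have "coloring_number \<le> (\<Sum>i<n. (2 ^ i - 1) div Suc i + 1)"
    unfolding coloring_number_def by (rule Least_le)
  then have "n * coloring_number \<le> n * (\<Sum>i<n. (2 ^ i - 1) div Suc i + 1)" by (rule mult_le_mono2)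
  then show ?thesis using greedy_number_le[OF assms] by linarith
qed

section \<open>Tuples whose subset sums avoid a relation\<close>

text \<open>Given the entries outside \<open>i\<close> and \<open>j\<close>, the sum over \<open>T'\<close> determines \<open>t j\<close> and then the sum over
  \<open>T\<close> determines \<open>t i\<close>.\<close>

lemma card_tuples_subset_sums_le:
  fixes V :: "'a :: ab_group_add set"
  assumes "finite V" and V: "\<And>v w. v \<in> V \<Longrightarrow> w \<in> V \<Longrightarrow> v + w \<in> V" "0 \<in> V"
    and "finite D" "T \<subseteq> D" "T' \<subseteq> D" and ij: "i \<in> T" "i \<notin> T'" "j \<in> T'"
    and "E \<subseteq> V \<times> V"
  shows "card {t \<in> D \<rightarrow>\<^sub>E V. (sum t T, sum t T') \<in> E} * card V ^ 2 \<le> card E * card V ^ card D"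
proof -
  let ?B = "{t \<in> D \<rightarrow>\<^sub>E V. (sum t T, sum t T') \<in> E}"
  let ?D = "D - {i, j}"
  let ?h = "\<lambda>t. ((sum t T, sum t T'), restrict t ?D)"
  have fin: "finite T" "finite T'" using assms finite_subset by blast+
  have "i \<noteq> j" using ij by blast
  have inj: "inj_on ?h ?B"
  proof (rule inj_onI)
    fix s t assume s: "s \<in> ?B" and t: "t \<in> ?B" and eq: "?h s = ?h t"
    have off: "s x = t x" if "x \<in> D" "x \<noteq> i" "x \<noteq> j" for x
    proof -
      have "restrict s ?D x = restrict t ?D x" using eq by simp
      then show ?thesis using that by simp
    qed
    have "sum s (T' - {j}) = sum t (T' - {j})"
      using assms(6) ij by (intro sum.cong) (auto intro!: off)
    moreover have "sum s T' = sum t T'" using eq by simp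
    ultimately have j: "s j = t j"
      using fin ij by (simp add: sum.remove)
    have "sum s (T - {i}) = sum t (T - {i})"
    proof (intro sum.cong refl)
      fix x assume "x \<in> T - {i}"
      then show "s x = t x" using j off assms(5) by (cases "x = j") auto
    qed
    moreover have "sum s T = sum t T" using eq by simp
    ultimately have i: "s i = t i"
      using fin ij by (simp add: sum.remove)
    show "s = t"
    proof (rule PiE_ext)
      show "s \<in> D \<rightarrow>\<^sub>E V" "t \<in> D \<rightarrow>\<^sub>E V" using s t by auto
      show "s x = t x" if "x \<in> D" for x using that i j off by blast
    qed
  qed
  have "?h ` ?B \<subseteq> E \<times> (?D \<rightarrow>\<^sub>E V)"
    by (auto simp: PiE_def Pi_def)
  moreover have "finite (E \<times> (?D \<rightarrow>\<^sub>E V))"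
    using assms finite_subset[of E "V \<times> V"] by (intro finite_cartesian_product finite_PiE) auto
  ultimately have "card ?B \<le> card (E \<times> (?D \<rightarrow>\<^sub>E V))"
    using inj by (intro card_inj_on_le)
  also have "\<dots> = card E * card V ^ card ?D"
    using assms by (simp add: card_cartesian_product card_PiE)
  finally have "card ?B * card V ^ 2 \<le> card E * card V ^ card ?D * card V ^ 2"
    by (rule mult_le_mono1)
  also have "\<dots> = card E * card V ^ (card ?D + 2)"
    by (simp only: power_add mult.assoc)
  also have "card ?D + 2 = card D"
  proof -
    have "card {i, j} \<le> card D" using assms by (intro card_mono) auto
    moreover have "card ?D = card D - card {i, j}" using assms by (intro card_Diff_subset) auto
    ultimately show ?thesis using \<open>i \<noteq> j\<close> by simp
  qed
  finally show ?thesis .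
qed

text \<open>A union bound: there are at most \<open>4 ^ card D\<close> pairs \<open>(T, T')\<close>,
  and each has its sums in \<open>E\<close> for at most a fraction
  \<open>card E / card V ^ 2\<close> of all tuples. Symmetry of \<open>E\<close> allows swapping
  \<open>T\<close> and \<open>T'\<close>, since possibly only one of them has an element outside the
  other.\<close>

lemma ex_tuple_avoiding:
  fixes V :: "'a :: ab_group_add set"
  assumes "finite V" and V: "\<And>v w. v \<in> V \<Longrightarrow> w \<in> V \<Longrightarrow> v + w \<in> V" "0 \<in> V"
    and "finite D" and E: "E \<subseteq> V \<times> V" "sym E"
    and less: "4 ^ card D * card E < card V ^ 2"
  shows "\<exists>t \<in> D \<rightarrow>\<^sub>E V. \<forall>T T'. T \<subseteq> D \<longrightarrow> T' \<subseteq> D \<longrightarrow> T \<noteq> {} \<longrightarrow> T' \<noteq> {} \<longrightarrow> T \<noteq> T' \<longrightarrow>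
           (sum t T, sum t T') \<notin> E" (is "\<exists>t \<in> _. ?avoids t")
proof (rule ccontr)
  assume neg: "\<not> ?thesis"
  define Q where "Q = {(T, T'). T \<subseteq> D \<and> T' \<subseteq> D \<and> T \<noteq> {} \<and> T' \<noteq> {} \<and> T \<noteq> T'}"
  define B where "B = (\<lambda>(T, T'). {t \<in> D \<rightarrow>\<^sub>E V. (sum t T, sum t T') \<in> E})"
  have QP: "Q \<subseteq> Pow D \<times> Pow D" by (auto simp: Q_def)
  then have finQ: "finite Q" using \<open>finite D\<close> finite_subset by blast
  have finPi: "finite (D \<rightarrow>\<^sub>E V)" using assms by (intro finite_PiE) auto
  have "card Q \<le> card (Pow D \<times> Pow D)"
    using QP \<open>finite D\<close> by (intro card_mono) auto
  also have "\<dots> = 4 ^ card D"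
    using \<open>finite D\<close> by (simp add: card_cartesian_product card_Pow flip: power_mult_distrib)
  finally have cardQ: "card Q \<le> 4 ^ card D" .
  have cardB: "card (B q) * card V ^ 2 \<le> card E * card V ^ card D" if "q \<in> Q" for q
  proof -
    obtain T T' where q: "q = (T, T')" by fastforce
    have Q: "T \<subseteq> D" "T' \<subseteq> D" "T \<noteq> {}" "T' \<noteq> {}" "T \<noteq> T'" using that by (auto simp: q Q_def)
    then consider i j where "i \<in> T" "i \<notin> T'" "j \<in> T'" | i j where "i \<in> T'" "i \<notin> T" "j \<in> T"
      by blast
    then show ?thesis
    proof cases
      case 1
      then show ?thesis
        using card_tuples_subset_sums_le[OF assms(1) V \<open>finite D\<close> Q(1,2) 1 E(1)] by (simp add: B_def q)
    next
      case 2
      have "B q = {t \<in> D \<rightarrow>\<^sub>E V. (sum t T', sum t T) \<in> E}"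
        using E(2) by (auto simp: B_def q dest: symD)
      then show ?thesis
        using card_tuples_subset_sums_le[OF assms(1) V \<open>finite D\<close> Q(2,1) 2 E(1)] by simp
    qed
  qed
  have "D \<rightarrow>\<^sub>E V \<subseteq> (\<Union>q\<in>Q. B q)"
  proof
    fix t assume t: "t \<in> D \<rightarrow>\<^sub>E V"
    have "\<exists>T T'. (T, T') \<in> Q \<and> (sum t T, sum t T') \<in> E"
    proof (rule ccontr)
      assume "\<not> ?thesis"
      then have "?avoids t"
        unfolding Q_def by simp blast
      from bexI[where P = ?avoids, OF this t] neg show False by contradiction
    qed
    then obtain T T' where q: "(T, T') \<in> Q" "(sum t T, sum t T') \<in> E" by blast
    then have "t \<in> B (T, T')" using t by (simp add: B_def)
    then show "t \<in> (\<Union>q\<in>Q. B q)" by (rule UN_I[OF q(1)])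
  qed
  moreover have "finite (B q)" for q
    using finite_subset[OF _ finPi, of "B q"] by (cases q) (simp add: B_def)
  ultimately have "card (D \<rightarrow>\<^sub>E V) \<le> card (\<Union>q\<in>Q. B q)"
    using finQ by (intro card_mono finite_UN_I)
  also have "\<dots> \<le> (\<Sum>q\<in>Q. card (B q))"
    by (rule card_UN_le[OF finQ])
  finally have "card V ^ card D \<le> (\<Sum>q\<in>Q. card (B q))"
    using \<open>finite D\<close> by (simp add: card_PiE)
  then have "card V ^ card D * card V ^ 2 \<le> (\<Sum>q\<in>Q. card (B q)) * card V ^ 2"
    by (rule mult_le_mono1)
  also have "\<dots> = (\<Sum>q\<in>Q. card (B q) * card V ^ 2)"
    by (rule sum_distrib_right)
  also have "\<dots> \<le> (\<Sum>q\<in>Q. card E * card V ^ card D)"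
    by (rule sum_mono[OF cardB])
  also have "\<dots> = card Q * card E * card V ^ card D" by simp
  also have "\<dots> \<le> 4 ^ card D * card E * card V ^ card D"
    using cardQ by simp
  also have "\<dots> < card V ^ 2 * card V ^ card D"
  proof -
    have "card V > 0" using assms(1) V(2) by (auto simp: card_gt_0_iff)
    then show ?thesis using less by simp
  qed
  finally show False by simp
qed

section \<open>Subset sums and decompositions of the binary matroid\<close>

text \<open>A vanishing sum would give two nonempty index sets with equal sums:
  \<open>{i, j}\<close> and \<open>{j}\<close> if \<open>T = {i}\<close>, otherwise
  \<open>{i}\<close> and \<open>T - {i}\<close>. The index \<open>j\<close> requires
  \<open>card D \<ge> 2\<close>; a single zero vector would satisfy \<open>inj\<close>.\<close>

lemma F2_subset_sums:
  fixes t :: "'i \<Rightarrow> nat \<Rightarrow> bit"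
  assumes "finite D" "card D \<ge> 2" and inj: "inj_on (sum t) (Pow D - {{}})"
    and "T \<subseteq> D" "T \<noteq> {}"
  shows "sum t T \<noteq> 0"
proof
  assume 0: "sum t T = 0"
  have injD: "A = B" if "sum t A = sum t B" "A \<subseteq> D" "B \<subseteq> D" "A \<noteq> {}" "B \<noteq> {}" for A B
    using inj_onD[OF inj that(1)] that by auto
  obtain i where i: "i \<in> T" using assms(5) by blast
  have finT: "finite T" using assms finite_subset by blast
  show False
  proof (cases "T = {i}")
    case True
    have "D \<noteq> {i}" using assms(2) by auto
    then obtain j where j: "j \<in> D" "j \<noteq> i" using i assms(4) by blast
    have "sum t {i, j} = sum t {j}" using 0 True j by simp
    then have "{i, j} = {j}" using i j assms(4) by (intro injD) auto
    then show False using j by blast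
  next
    case False
    have "t i + sum t (T - {i}) = 0" using 0 finT i by (simp add: sum.remove)
    then have "sum t {i} = sum t (T - {i})" using F2_eq_if_add_eq_0 by simp
    then have "{i} = T - {i}" using False i assms(4) by (intro injD) auto
    then show False by blast
  qed
qed

text \<open>Condition (ii) is applied to two transversals: an arbitrary one bounds the number of
  blocks by \<open>b * n\<close>; one through the nonzero vectors of a subspace would contradict
  \<open>b * d < 2 ^ d - 1\<close> if the second bound failed.\<close>

lemma F2_decomposition_bounds:
  assumes dec: "matroid.is_decomposition (F2_ground n) (F2_indep n) b c P"
    and n: "n \<ge> 1" and d: "d \<ge> 2" "b * d < 2 ^ d - 1"
  defines "k \<equiv> matroid.coloring_number (F2_ground n) (F2_indep n)"
  shows "2 ^ n - 1 \<le> real b * n * (c * k)" "2 ^ n \<le> 4 ^ d * (c * k)"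
proof -
  interpret matroid "F2_ground n" "F2_indep n" by (rule matroid_F2)
  have part: "partition_on (F2_ground n) P"
    and small: "\<And>X. X \<in> P \<Longrightarrow> real (card X) \<le> c * k"
    and trans: "\<And>v. (\<And>X. X \<in> P \<Longrightarrow> v X \<in> X) \<Longrightarrow> colorable b (v ` P)"
    using dec unfolding is_decomposition_def k_def by blast+
  have finP: "finite P" using finite_elements[OF finite_F2_ground part] .
  have UP: "\<Union>P = F2_ground n" using part by (simp add: partition_on_def)
  have finX: "finite X" if "X \<in> P" for X
    using that UP finite_F2_ground by (metis Union_upper finite_subset)
  have neX: "X \<noteq> {}" if "X \<in> P" for X using partition_onD3[OF part] that by blast
  have uniq: "X = Y" if "X \<in> P" "Y \<in> P" "x \<in> X" "x \<in> Y" for X Y x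
    using disjointD[OF partition_onD2[OF part] that(1,2)] that(3,4) by blast
  have card_sum: "(\<Sum>X\<in>P. card X) = 2 ^ n - 1"
  proof -
    have "card (\<Union>P) = (\<Sum>X\<in>P. card X)"
      using part finX by (intro card_Union_disjoint) (auto simp: partition_on_def disjoint_def pairwise_def disjnt_def)
    then show ?thesis by (simp add: UP card_F2_ground)
  qed
  have card_sum_real: "(\<Sum>X\<in>P. real (card X)) = 2 ^ n - 1"
    using arg_cong[OF card_sum, of real] by (simp add: of_nat_diff)
  have "(2 :: nat) ^ 1 \<le> 2 ^ n" using n by (intro power_increasing) auto
  then have "P \<noteq> {}" using card_sum by auto
  then obtain X where "X \<in> P" by blast
  then have "1 \<le> card X" using finX neX by (simp add: Suc_le_eq card_gt_0_iff)
  then have ck: "1 \<le> c * k" using small[OF \<open>X \<in> P\<close>] by linarith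

  define v0 where "v0 X = (SOME x. x \<in> X)" for X :: "(nat \<Rightarrow> bit) set"
  have v0: "v0 X \<in> X" if "X \<in> P" for X
    using neX[OF that] unfolding v0_def by (simp add: some_in_eq)
  have "inj_on v0 P" using v0 uniq by (metis inj_onI)
  then have "card P = card (v0 ` P)" by (simp add: card_image)
  also have "\<dots> \<le> b * n"
    using trans[OF v0] card_F2_indep_le by (intro card_colorable_le) auto
  finally have cardP: "card P \<le> b * n" .
  have "2 ^ n - 1 \<le> (\<Sum>X\<in>P. c * k)"
    unfolding card_sum_real[symmetric] by (rule sum_mono[OF small])
  also have "\<dots> = real (card P) * (c * k)" by simp
  also have "\<dots> \<le> real (b * n) * (c * k)"
    using cardP ck by (intro mult_right_mono) (simp_all del: of_nat_mult)
  finally show "2 ^ n - 1 \<le> real b * n * (c * k)" by simp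

  text \<open>The pair \<open>(0, 0)\<close> makes the relation reflexive on the whole space.\<close>
  define E where "E = insert (0, 0) (\<Union>X\<in>P. X \<times> X)"
  have "card E \<le> Suc (card (\<Union>X\<in>P. X \<times> X))"
    unfolding E_def by (rule card_insert_le_m1[of "Suc _", simplified]) simp
  also have "card (\<Union>X\<in>P. X \<times> X) \<le> (\<Sum>X\<in>P. card (X \<times> X))" by (rule card_UN_le[OF finP])
  finally have "real (card E) \<le> 1 + (\<Sum>X\<in>P. real (card X) * card X)"
    by (simp add: card_cartesian_product flip: of_nat_mult of_nat_sum)
  \<comment> \<open>One factor is bounded by the block size; the other sums to the size of the
    ground set.\<close>
  also have "(\<Sum>X\<in>P. real (card X) * card X) \<le> (\<Sum>X\<in>P. real (card X) * (c * k))"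
    by (intro sum_mono mult_left_mono small) auto
  also have "\<dots> = (2 ^ n - 1) * (c * k)"
    by (simp only: card_sum_real flip: sum_distrib_right)
  \<comment> \<open>The \<open>1\<close> for the pair \<open>(0, 0)\<close> is absorbed by
    \<open>ck\<close>, as \<open>2 ^ n - 1\<close> grows to \<open>2 ^ n\<close>.\<close>
  finally have cardE: "real (card E) \<le> 2 ^ n * (c * k)"
    using ck by (simp add: algebra_simps)

  show "2 ^ n \<le> 4 ^ d * (c * k)"
  proof (rule ccontr)
    assume "\<not> ?thesis"
    then have less: "4 ^ d * (c * k) < 2 ^ n" by simp
    have "real (4 ^ d * card E) \<le> 4 ^ d * (2 ^ n * (c * k))"
      using cardE by simp
    also have "\<dots> = 2 ^ n * (4 ^ d * (c * k))" by simp
    also have "\<dots> < 2 ^ n * 2 ^ n" using less by (intro mult_strict_left_mono) auto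
    also have "\<dots> = real ((2 ^ n)\<^sup>2)" by (simp add: power2_eq_square)
    finally have lessE: "4 ^ card {..<d} * card E < card (F2_space n) ^ 2"
      by (simp only: of_nat_less_iff card_F2_space card_lessThan)
    have closed: "v + w \<in> F2_space n" if "v \<in> F2_space n" "w \<in> F2_space n" for v w
      using that by (rule F2.subspace_add[OF F2_space_subspace])
    have zero: "0 \<in> F2_space n" by (rule F2.subspace_0[OF F2_space_subspace])
    have EV: "E \<subseteq> F2_space n \<times> F2_space n"
      using zero UP unfolding E_def F2_ground_def by blast
    have "sym E" unfolding E_def sym_def by blast
    obtain t where t: "t \<in> {..<d} \<rightarrow>\<^sub>E F2_space n"
      and avoid: "\<And>T T'. T \<subseteq> {..<d} \<Longrightarrow> T' \<subseteq> {..<d} \<Longrightarrow> T \<noteq> {} \<Longrightarrow> T' \<noteq> {} \<Longrightarrow> T \<noteq> T' \<Longrightarrow>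
           (sum t T, sum t T') \<notin> E"
      using ex_tuple_avoiding[OF finite_F2_space closed zero finite_lessThan EV \<open>sym E\<close> lessE]
      by blast
    have sumV: "sum t T \<in> F2_space n" if "T \<subseteq> {..<d}" for T
      using that t by (intro F2.subspace_sum[OF F2_space_subspace]) auto
    \<comment> \<open>Equal sums form a diagonal pair of \<open>E\<close>, so avoiding
      \<open>E\<close> also forces the sums to be distinct.\<close>
    have refl: "(x, x) \<in> E" if "x \<in> F2_space n" for x
      using that UP unfolding E_def F2_ground_def by blast
    have inj: "inj_on (sum t) (Pow {..<d} - {{}})"
    proof (rule inj_onI)
      fix T T' assume *: "T \<in> Pow {..<d} - {{}}" "T' \<in> Pow {..<d} - {{}}" "sum t T = sum t T'"
      then have "(sum t T, sum t T') \<in> E" using refl[OF sumV] by simp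
      then show "T = T'" using avoid[of T T'] * by blast
    qed
    define Z where "Z = sum t ` (Pow {..<d} - {{}})"
    have "Z \<subseteq> F2_ground n"
      using sumV F2_subset_sums[OF _ _ inj] d(1) by (auto simp: Z_def F2_ground_def)
    have cardZ: "card Z = 2 ^ d - 1"
      unfolding Z_def by (subst card_image[OF inj]) (simp add: card_Pow)
    have Z_span: "Z \<subseteq> F2.span (t ` {..<d})"
    proof
      fix z assume "z \<in> Z"
      then obtain T where T: "T \<subseteq> {..<d}" "z = sum t T" unfolding Z_def by blast
      show "z \<in> F2.span (t ` {..<d})"
        unfolding T(2) by (intro F2.span_sum F2.span_base imageI subsetD[OF T(1)])
    qed
    have Z_uniq: "x = y" if "x \<in> Z" "y \<in> Z" "X \<in> P" "x \<in> X" "y \<in> X" for x y X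
    proof -
      have "(x, y) \<in> E" using that unfolding E_def by blast
      then show ?thesis using that(1,2) avoid unfolding Z_def by blast
    qed
    \<comment> \<open>By \<open>Z_uniq\<close> a block meets \<open>Z\<close> in at most one vector,
      so this choice picks all of \<open>Z\<close>; blocks missing \<open>Z\<close> receive an
      arbitrary element.\<close>
    define v where "v X = (if Z \<inter> X = {} then v0 X else SOME x. x \<in> Z \<inter> X)" for X
    have vZ: "v X \<in> Z \<inter> X" if "Z \<inter> X \<noteq> {}" for X
      using that unfolding v_def by (simp only: if_False some_in_eq not_False_eq_True)
    have vX: "v X \<in> X" if "X \<in> P" for X
      using vZ[of X] v0[OF that] by (cases "Z \<inter> X = {}") (auto simp: v_def)
    have "Z \<subseteq> v ` P"
    proof
      fix z assume z: "z \<in> Z"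
      then obtain X where X: "X \<in> P" "z \<in> X" using \<open>Z \<subseteq> F2_ground n\<close> UP by blast
      then have "v X = z" using vZ[of X] z Z_uniq by blast
      then show "z \<in> v ` P" using X by blast
    qed
    then have "colorable b Z" using trans[OF vX] colorable_subset by blast
    then have "card Z \<le> b * d"
    proof (rule card_colorable_le)
      fix A assume A: "A \<in> F2_indep n" "A \<subseteq> Z"
      then have "card A \<le> card (t ` {..<d})"
        using F2.independent_span_bound[of "t ` {..<d}" A] Z_span by (auto simp: F2_indep_def)
      also have "\<dots> \<le> d" using card_image_le[of "{..<d}" t] by simp
      finally show "card A \<le> d" .
    qed
    with cardZ d(2) show False by simp
  qed
qed

text \<open>With the bound on the coloring number, the two bounds give
  \<open>1 \<le> 2 * c * 2 ^ d\<close> and \<open>n \<le> 2 * c * 4 ^ d\<close>. Multiplying them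
  yields \<open>4 * c ^ 2 * 2 ^ (3 * d)\<close>, and \<open>3 * d \<le> d ^ 2 + d\<close> because
  \<open>d \<ge> 2\<close>.\<close>

lemma F2_decomposable_bound:
  assumes dec: "matroid.decomposable (F2_ground n) (F2_indep n) b c"
    and n: "n \<ge> 1" and c: "c > 0" and d: "d \<ge> 2" "b * d < 2 ^ d - 1"
  shows "real n \<le> 4 * c ^ 2 * 2 ^ (d ^ 2 + d)"
proof -
  interpret matroid "F2_ground n" "F2_indep n" by (rule matroid_F2)
  obtain P where P: "is_decomposition b c P" using dec unfolding decomposable_def by blast
  define k where "k = real coloring_number"
  define N :: real where "N = 2 ^ n"
  note bounds = F2_decomposition_bounds[OF P n d, folded k_def N_def]
  have "real (n * coloring_number) \<le> real (2 * 2 ^ n)"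
    using F2_coloring_number_le[OF n] by (simp only: of_nat_le_iff)
  then have k: "n * k \<le> 2 * N" by (simp add: k_def N_def)
  have N: "2 \<le> N" using power_increasing[OF n, of "2 :: real"] by (simp add: N_def)
  have "real n * N \<le> n * (4 ^ d * (c * k))" using bounds(2) by (intro mult_left_mono) auto
  also have "\<dots> = 4 ^ d * c * (n * k)" by simp
  also have "\<dots> \<le> 4 ^ d * c * (2 * N)" using k c by (intro mult_left_mono) auto
  finally have n_le: "real n \<le> 2 * c * 4 ^ d" using N by (simp add: mult_ac)
  have "N / 2 \<le> N - 1" using N by simp
  also have "\<dots> \<le> b * c * (n * k)" using bounds(1) by (simp add: algebra_simps)
  also have "\<dots> \<le> b * c * (2 * N)" using k c by (intro mult_left_mono) auto
  finally have "N * 1 \<le> N * (4 * b * c)" by (simp add: mult_ac)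
  then have bc: "1 \<le> 4 * b * c" using N by (subst (asm) mult_le_cancel_left_pos) auto
  \<comment> \<open>This trades \<open>b\<close> for \<open>2 ^ d\<close>, since the final bound
    mentions only \<open>c\<close> and \<open>d\<close>.\<close>
  have "b * 2 \<le> b * d" using d(1) by (rule mult_le_mono2)
  then have "b * 2 \<le> 2 ^ d" using d(2) by linarith
  then have "real (b * 2) \<le> real (2 ^ d)" by (simp only: of_nat_le_iff)
  then have "(2 * c) * (real b * 2) \<le> (2 * c) * 2 ^ d" using c by (intro mult_left_mono) auto
  then have "1 \<le> 2 * c * 2 ^ d" using bc by (simp add: mult_ac)
  then have "2 * c * 4 ^ d * 1 \<le> 2 * c * 4 ^ d * (2 * c * 2 ^ d)"
    using c by (intro mult_left_mono) auto
  also have "\<dots> = 4 * c ^ 2 * (2 ^ (2 * d) * 2 ^ d)"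
    by (simp add: power_mult power2_eq_square)
  also have "\<dots> \<le> 4 * c ^ 2 * 2 ^ (d ^ 2 + d)"
  proof -
    have "2 * d + d \<le> d ^ 2 + d" using d(1) by (simp add: power2_eq_square)
    then have "(2 :: real) ^ (2 * d + d) \<le> 2 ^ (d ^ 2 + d)" by (intro power_increasing) auto
    then show ?thesis unfolding power_add[symmetric] by (rule mult_left_mono) simp
  qed
  finally show ?thesis using n_le by simp
qed

section \<open>Existence of \<open>d\<close> and the theorem\<close>

lemma ex_exp_quotient_greater:
  "\<exists>d>0. (2 ^ d - 1) / real d > real b"
proof -
  \<comment> \<open>With \<open>m = 2 * Suc b\<close>, so that \<open>d = 2 * m\<close>, squaring
    \<open>m + 1 \<le> 2 ^ m\<close> gives \<open>2 ^ d \<ge> (m + 1) ^ 2\<close>, which exceeds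
    \<open>b * d + 1\<close>.\<close>
  define d where "d = 4 * Suc b"
  have "(2 * real (Suc b) + 1) \<le> 2 ^ (2 * Suc b)"
    using less_exp[of "2 * Suc b"] by (simp add: Suc_le_eq[symmetric] flip: of_nat_le_iff[where 'a=real])
  then have "(2 * real (Suc b) + 1) ^ 2 \<le> (2 ^ (2 * Suc b)) ^ 2" by (intro power_mono) auto
  also have "\<dots> = 2 ^ d" by (simp add: d_def mult.commute flip: power_mult del: power_Suc)
  finally have "real b * real d < 2 ^ d - 1"
    by (simp add: d_def power2_eq_square algebra_simps)
  then show ?thesis by (intro exI[of _ d]) (simp add: d_def pos_less_divide_eq)
qed

theorem theorem1:
  fixes b d :: nat and c :: real
  assumes "b > 0" and "c > 0"
    and "d = (LEAST d. d > 0 \<and> (2 ^ d - 1) / real d > real b)"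
  shows "(\<forall>n\<ge>1. matroid.decomposable (F2_ground n) (F2_indep n) b c \<longrightarrow>
                  4 * c ^ 2 * 2 ^ (d ^ 2 + d) \<ge> real n) \<and>
         (\<forall>\<^sub>F n in sequentially. \<not> matroid.decomposable (F2_ground n) (F2_indep n) b c)"
proof -
  have d: "d > 0 \<and> (2 ^ d - 1) / real d > real b"
    unfolding assms(3) by (rule LeastI_ex) (rule ex_exp_quotient_greater)
  \<comment> \<open>For \<open>d = 1\<close> the quotient is \<open>1\<close>, which does not exceed
    \<open>b\<close>.\<close>
  have "d \<noteq> 1" using d assms(1) by auto
  then have d2: "d \<ge> 2" using d by linarith
  have "real b * d < 2 ^ d - 1" using d pos_less_divide_eq[of "real d" "real b"] by simp
  then have "real (b * d) < real (2 ^ d - 1)" by (simp add: of_nat_diff)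
  then have bd: "b * d < 2 ^ d - 1" by (simp only: of_nat_less_iff)
  have bound: "real n \<le> 4 * c ^ 2 * 2 ^ (d ^ 2 + d)"
    if "n \<ge> 1" "matroid.decomposable (F2_ground n) (F2_indep n) b c" for n
    using F2_decomposable_bound[OF that(2,1) assms(2) d2 bd] .
  \<comment> \<open>The bound does not depend on \<open>n\<close>, so large \<open>n\<close> exceed
    it.\<close>
  have "\<forall>\<^sub>F n in sequentially. real n > 4 * c ^ 2 * 2 ^ (d ^ 2 + d)"
    using filterlim_real_sequentially unfolding filterlim_at_top_dense by blast
  then have "\<forall>\<^sub>F n in sequentially. \<not> matroid.decomposable (F2_ground n) (F2_indep n) b c"
    using eventually_ge_at_top[of 1] by eventually_elim (use bound in force)
  then show ?thesis using bound by blast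
qed

end
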